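(* Assume that $\mathcal{D}$ is an inclusion-closed collection and that the mean random dynamical system $\Phi$ on $L^p(\Omega,\mathcal{F};X)$ over $(\Omega,\mathcal{F},\{\mathcal{F}_t\}_{t\in\mathbb{R}},P)$ possesses an invariant weak $\mathcal{D}$-pullback mean random attractor $\mathcal{A}\in\mathcal{D}$. Then for every $t\in\mathbb{R}$ $$\mathcal{A}(t)=\{\phi(t):\phi\in\mathcal{D}\text{ is a complete trajectory}\}.$$
   Context: $X$ is a Banach space, $p\in(1,\infty)$, and $(\Omega,\mathcal{F},\{\mathcal{F}_t\}_{t\in\mathbb{R}},P)$ is a complete filtered probability space, $\{\mathcal{F}_t\}$ being an increasing right continuous family of sub-$\sigma$-algebras of $\mathcal{F}$ containing all $P$-null sets. $L^p(\Omega,\mathcal{F};X)$ is the Banach space of Bochner integrable $y:\Omega\to X$ with $\int_\Omega\|y\|_X^pdP<\infty$, and $L^p(\Omega,\mathcal{F}_t;X)$ its subspace of strongly $\mathcal{F}_t$-measurable elements. $\mathcal{D}$ is a given collection of families $D=\{D(t)\}_{t\in\mathbb{R}}$ of non-empty bounded sets $D(t)\subset L^p(\Omega,\mathcal{F}_t;X)$; it is inclusion-closed if $D\in\mathcal{D}$ and $\emptyset\ne B(t)\subset D(t)$ for all $t$ imply $\{B(t)\}_{t\in\mathbb{R}}\in\mathcal{D}$. A mean random dynamical system on $L^p(\Omega,\mathcal{F};X)$ over this filtered space is a family of maps $\Phi(t,\tau):L^p(\Omega,\mathcal{F}_\tau;X)\to L^p(\Omega,\mathcal{F}_{t+\tau};X)$,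 $t\ge0$, $\tau\in\mathbb{R}$, with $\Phi(0,\tau)=\mathrm{id}$ and $\Phi(t+s,\tau)=\Phi(t,s+\tau)\circ\Phi(s,\tau)$ for $t,s\ge0$. $K\in\mathcal{D}$ is $\mathcal{D}$-pullback weakly attracting if for all $\tau\in\mathbb{R}$, $D\in\mathcal{D}$ and any weak neighborhood $\mathcal{N}^w(K(\tau))$ of $K(\tau)$ in $L^p(\Omega,\mathcal{F}_\tau;X)$ there is $T>0$ with $\Phi(t,\tau-t)D(\tau-t)\subset\mathcal{N}^w(K(\tau))$ for all $t\ge T$. $\mathcal{A}\in\mathcal{D}$ is a weak $\mathcal{D}$-pullback mean random attractor if (1) $\mathcal{A}(\tau)$ is weakly compact in $L^p(\Omega,\mathcal{F}_\tau;X)$ for all $\tau$; (2) $\mathcal{A}$ is $\mathcal{D}$-pullback weakly attracting; (3) if $B\in\mathcal{D}$ satisfies (1) and (2), then $\mathcal{A}(t)\subset B(t)$ for all $t$. It is invariant if $\mathcal{A}(t)=\Phi(\tau,t-\tau)\mathcal{A}(t-\tau)$ for all $\tau\ge0$, $t\in\mathbb{R}$. A map $\phi$ with $\phi(t)\in L^p(\Omega,\mathcal{F}_t;X)$ for all $t\in\mathbb{R}$ is a complete trajectory if $\phi(t)=\Phi(t-s,s)\phi(s)$ for all $s<t$; $\phi\in\mathcal{D}$ means that the family of singletons $\{\{\phi(t)\}\}_{t\in\mathbb{R}}$ belongs to $\mathcal{D}$. *)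

theory Defs
  imports "HOL-Probability.Probability"
begin

section \<open>Filtered probability spaces\<close>

text \<open>Only the \<open>\<sigma>\<close>-algebra of \<open>F t\<close> matters; the measure carried by \<open>F t\<close> is never used.\<close>

locale complete_filtered_prob_space =
  prob_space M + complete_measure M + filtration "space M" F
  for M :: "'a measure" and F :: "real \<Rightarrow> 'a measure" +
  assumes subalgebra_F: "subalgebra M (F t)"
    and right_continuous_F: "sets (F t) = (\<Inter>s\<in>{t<..}. sets (F s))"
    and null_sets_F: "null_sets M \<subseteq> sets (F t)"


section \<open>Bochner spaces\<close>

text \<open>
  The library's \<open>integrable\<close> is restricted to second countable (hence separable) target spaces.
  For an arbitrary Banach space, strong measurability replaces Borel measurability.
\<close>

definition strongly_measurable :: "'a measure \<Rightarrow> ('a \<Rightarrow> 'b::real_normed_vector) \<Rightarrow> bool" where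
  "strongly_measurable N f \<longleftrightarrow>
     (\<exists>s. (\<forall>i. simple_function N (s i)) \<and> (\<forall>x\<in>space N. (\<lambda>i. s i x) \<longlonglongrightarrow> f x))"

definition bochner_integrable :: "'a measure \<Rightarrow> ('a \<Rightarrow> 'b::real_normed_vector) \<Rightarrow> bool" where
  "bochner_integrable M f \<longleftrightarrow>
     strongly_measurable M f \<and>
     (\<exists>s. (\<forall>i. Bochner_Integration.simple_bochner_integrable M (s i)) \<and>
          (\<lambda>i. \<integral>\<^sup>+x. ennreal (norm (f x - s i x)) \<partial>M) \<longlonglongrightarrow> 0)"

definition Lp_fun :: "'a measure \<Rightarrow> real \<Rightarrow> ('a \<Rightarrow> 'b::real_normed_vector) set" where
  "Lp_fun M p = {f. bochner_integrable M f \<and> integrable M (\<lambda>x. norm (f x) powr p)}"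

definition Lp_fun_norm :: "'a measure \<Rightarrow> real \<Rightarrow> ('a \<Rightarrow> 'b::real_normed_vector) \<Rightarrow> real" where
  "Lp_fun_norm M p f = (\<integral>x. norm (f x) powr p \<partial>M) powr (1 / p)"

definition AE_eq_rel :: "'a measure \<Rightarrow> real \<Rightarrow> (('a \<Rightarrow> 'b::real_normed_vector) \<times> ('a \<Rightarrow> 'b)) set" where
  "AE_eq_rel M p = {(f, g). f \<in> Lp_fun M p \<and> g \<in> Lp_fun M p \<and> (AE x in M. f x = g x)}"

type_synonym ('a, 'b) Lp_class = "('a \<Rightarrow> 'b) set"

definition Lp_class :: "'a measure \<Rightarrow> real \<Rightarrow> ('a \<Rightarrow> 'b::real_normed_vector) \<Rightarrow> ('a, 'b) Lp_class" where
  "Lp_class M p f = AE_eq_rel M p `` {f}"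

text \<open>
  \<open>Lp M p N\<close> is the subspace of the Bochner space over \<open>M\<close> consisting of the elements that are
  strongly measurable with respect to the sub-\<open>\<sigma>\<close>-algebra of \<open>N\<close>; its elements are equivalence
  classes modulo equality almost everywhere, and \<open>Lp M p M\<close> is the full space.
\<close>

definition Lp :: "'a measure \<Rightarrow> real \<Rightarrow> 'a measure \<Rightarrow> ('a, 'b::real_normed_vector) Lp_class set" where
  "Lp M p N = {u \<in> Lp_fun M p // AE_eq_rel M p. \<exists>f\<in>u. strongly_measurable N f}"

definition Lp_bounded :: "'a measure \<Rightarrow> real \<Rightarrow> ('a, 'b::real_normed_vector) Lp_class set \<Rightarrow> bool" where
  "Lp_bounded M p S \<longleftrightarrow> (\<exists>C. \<forall>u\<in>S. \<forall>f\<in>u. Lp_fun_norm M p f \<le> C)"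


section \<open>The weak topology\<close>

text \<open>
  Bounded linear functionals on \<open>Lp M p N\<close>. The operations and the norm on classes are those of
  arbitrary representatives; values outside \<open>Lp M p N\<close> are irrelevant.
\<close>

definition Lp_dual ::
  "'a measure \<Rightarrow> real \<Rightarrow> 'a measure \<Rightarrow> (('a, 'b::real_normed_vector) Lp_class \<Rightarrow> real) set" where
  "Lp_dual M p N = {l.
     (\<forall>u\<in>Lp M p N. \<forall>v\<in>Lp M p N. \<forall>f\<in>u. \<forall>g\<in>v. l (Lp_class M p (\<lambda>x. f x + g x)) = l u + l v) \<and>
     (\<forall>c. \<forall>u\<in>Lp M p N. \<forall>f\<in>u. l (Lp_class M p (\<lambda>x. c *\<^sub>R f x)) = c * l u) \<and>
     (\<exists>C. \<forall>u\<in>Lp M p N. \<forall>f\<in>u. \<bar>l u\<bar> \<le> C * Lp_fun_norm M p f)}"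

definition weak_Lp :: "'a measure \<Rightarrow> real \<Rightarrow> 'a measure \<Rightarrow> ('a, 'b::real_normed_vector) Lp_class topology" where
  "weak_Lp M p N =
     topology_generated_by {{u \<in> Lp M p N. l u \<in> U} |l U. l \<in> Lp_dual M p N \<and> open U}"

definition nbhd_of :: "'c topology \<Rightarrow> 'c set \<Rightarrow> 'c set \<Rightarrow> bool" where
  "nbhd_of T S V \<longleftrightarrow> V \<subseteq> topspace T \<and> (\<exists>U. openin T U \<and> S \<subseteq> U \<and> U \<subseteq> V)"


section \<open>Mean random dynamical systems and their attractors\<close>

type_synonym ('a, 'b) Lp_family = "real \<Rightarrow> ('a, 'b) Lp_class set"

definition Lp_collection ::
  "'a measure \<Rightarrow> real \<Rightarrow> (real \<Rightarrow> 'a measure) \<Rightarrow> ('a, 'b::real_normed_vector) Lp_family set \<Rightarrow> bool" where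
  "Lp_collection M p F \<D> \<longleftrightarrow>
     (\<forall>D\<in>\<D>. \<forall>t. D t \<noteq> {} \<and> D t \<subseteq> Lp M p (F t) \<and> Lp_bounded M p (D t))"

definition inclusion_closed :: "('a, 'b) Lp_family set \<Rightarrow> bool" where
  "inclusion_closed \<D> \<longleftrightarrow>
     (\<forall>D\<in>\<D>. \<forall>B. (\<forall>t. B t \<noteq> {} \<and> B t \<subseteq> D t) \<longrightarrow> B \<in> \<D>)"

definition mean_RDS ::
  "'a measure \<Rightarrow> real \<Rightarrow> (real \<Rightarrow> 'a measure) \<Rightarrow>
    (real \<Rightarrow> real \<Rightarrow> ('a, 'b::real_normed_vector) Lp_class \<Rightarrow> ('a, 'b) Lp_class) \<Rightarrow> bool" where
  "mean_RDS M p F \<Phi> \<longleftrightarrow>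
     (\<forall>t\<ge>0. \<forall>\<tau>. \<forall>u\<in>Lp M p (F \<tau>). \<Phi> t \<tau> u \<in> Lp M p (F (t + \<tau>))) \<and>
     (\<forall>\<tau>. \<forall>u\<in>Lp M p (F \<tau>). \<Phi> 0 \<tau> u = u) \<and>
     (\<forall>t\<ge>0. \<forall>s\<ge>0. \<forall>\<tau>. \<forall>u\<in>Lp M p (F \<tau>). \<Phi> (t + s) \<tau> u = \<Phi> t (s + \<tau>) (\<Phi> s \<tau> u))"

definition pullback_weakly_attracting ::
  "'a measure \<Rightarrow> real \<Rightarrow> (real \<Rightarrow> 'a measure) \<Rightarrow>
    (real \<Rightarrow> real \<Rightarrow> ('a, 'b::real_normed_vector) Lp_class \<Rightarrow> ('a, 'b) Lp_class) \<Rightarrow>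
    ('a, 'b) Lp_family set \<Rightarrow> ('a, 'b) Lp_family \<Rightarrow> bool" where
  "pullback_weakly_attracting M p F \<Phi> \<D> K \<longleftrightarrow>
     K \<in> \<D> \<and>
     (\<forall>\<tau>. \<forall>D\<in>\<D>. \<forall>V. nbhd_of (weak_Lp M p (F \<tau>)) (K \<tau>) V \<longrightarrow>
        (\<exists>T>0. \<forall>t\<ge>T. \<Phi> t (\<tau> - t) ` D (\<tau> - t) \<subseteq> V))"

definition weak_mean_random_attractor ::
  "'a measure \<Rightarrow> real \<Rightarrow> (real \<Rightarrow> 'a measure) \<Rightarrow>
    (real \<Rightarrow> real \<Rightarrow> ('a, 'b::real_normed_vector) Lp_class \<Rightarrow> ('a, 'b) Lp_class) \<Rightarrow>
    ('a, 'b) Lp_family set \<Rightarrow> ('a, 'b) Lp_family \<Rightarrow> bool" where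
  "weak_mean_random_attractor M p F \<Phi> \<D> A \<longleftrightarrow>
     A \<in> \<D> \<and>
     (\<forall>\<tau>. compactin (weak_Lp M p (F \<tau>)) (A \<tau>)) \<and>
     pullback_weakly_attracting M p F \<Phi> \<D> A \<and>
     (\<forall>B\<in>\<D>. (\<forall>\<tau>. compactin (weak_Lp M p (F \<tau>)) (B \<tau>)) \<and>
        pullback_weakly_attracting M p F \<Phi> \<D> B \<longrightarrow> (\<forall>t. A t \<subseteq> B t))"

definition invariant_family ::
  "(real \<Rightarrow> real \<Rightarrow> ('a, 'b) Lp_class \<Rightarrow> ('a, 'b) Lp_class) \<Rightarrow> ('a, 'b) Lp_family \<Rightarrow> bool" where
  "invariant_family \<Phi> A \<longleftrightarrow> (\<forall>\<tau>\<ge>0. \<forall>t. A t = \<Phi> \<tau> (t - \<tau>) ` A (t - \<tau>))"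

definition complete_trajectory ::
  "'a measure \<Rightarrow> real \<Rightarrow> (real \<Rightarrow> 'a measure) \<Rightarrow>
    (real \<Rightarrow> real \<Rightarrow> ('a, 'b::real_normed_vector) Lp_class \<Rightarrow> ('a, 'b) Lp_class) \<Rightarrow>
    (real \<Rightarrow> ('a, 'b) Lp_class) \<Rightarrow> bool" where
  "complete_trajectory M p F \<Phi> \<phi> \<longleftrightarrow>
     (\<forall>t. \<phi> t \<in> Lp M p (F t)) \<and> (\<forall>s t. s < t \<longrightarrow> \<phi> t = \<Phi> (t - s) s (\<phi> s))"

end

theory Submission
  imports Defs
begin

text \<open>
  A point of the attractor has a backward orbit inside the attractor by invariance, which
  gives a complete trajectory through it. Conversely, the singletons of a complete trajectory in
  the collection are attracted, so \<open>\<phi> t\<close> lies in every weak neighbourhood of \<open>A t\<close>; as the dual of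
  the Bochner space separates points, a point outside \<open>A t\<close> is missed by some such neighbourhood.
  A separating functional has the form \<open>u \<mapsto> \<integral>x\<in>E. h (u x)\<close> with \<open>h\<close> in the dual of the Banach
  space, obtained from the Hahn-Banach theorem and the separability of the range of \<open>u\<close>.
\<close>

section \<open>The Hahn-Banach theorem\<close>

definition sublinear :: "('v::real_vector \<Rightarrow> real) \<Rightarrow> bool" where
  "sublinear q \<longleftrightarrow> (\<forall>x y. q (x + y) \<le> q x + q y) \<and> (\<forall>c\<ge>0. \<forall>x. q (c *\<^sub>R x) = c * q x)"

lemma sublinear_add: "sublinear q \<Longrightarrow> q (x + y) \<le> q x + q y"
  by (simp add: sublinear_def)

lemma sublinear_scaleR: "sublinear q \<Longrightarrow> 0 \<le> c \<Longrightarrow> q (c *\<^sub>R x) = c * q x"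
  by (simp add: sublinear_def)

lemma sublinear_zero: "sublinear q \<Longrightarrow> q 0 = 0"
  using sublinear_scaleR[of q 0 0] by simp

lemma sublinear_minus: "sublinear q \<Longrightarrow> - q (- x) \<le> q x"
  using sublinear_add[of q x "- x"] sublinear_zero[of q] by simp

text \<open>For \<open>c > 0\<close> the reverse inequality comes from \<open>scale\<close> itself,
  applied with factor \<open>inverse c\<close> to the vector \<open>c *\<^sub>R x\<close>;
  \<open>c = 0\<close> is covered by \<open>zero\<close>.\<close>

lemma sublinearI:
  assumes add: "\<And>x y. q (x + y) \<le> q x + q y"
    and scale: "\<And>c x. 0 < c \<Longrightarrow> q (c *\<^sub>R x) \<le> c * q x"
    and zero: "q 0 = 0"
  shows "sublinear q"
proof -
  have "q (c *\<^sub>R x) = c * q x" if "0 \<le> c" for c x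
  proof (cases "c = 0")
    case False
    with that have c: "0 < c" by simp
    have "q (inverse c *\<^sub>R (c *\<^sub>R x)) \<le> inverse c * q (c *\<^sub>R x)"
      using c by (intro scale) simp
    then have "c * q x \<le> q (c *\<^sub>R x)"
      using c by (simp add: field_simps)
    with scale[OF c, of x] show ?thesis by simp
  qed (simp add: zero)
  with add show ?thesis by (simp add: sublinear_def)
qed

text \<open>The bound \<open>b\<close> keeps every infimum finite. The index \<open>k\<close> in
  \<open>add\<close> and \<open>scale\<close> may depend on the points, which is weak enough to
  cover both a family indexed by real shifts and a chain of functionals.\<close>

lemma sublinear_INF:
  assumes I: "I \<noteq> {}"
    and lower: "\<And>i x. i \<in> I \<Longrightarrow> b x \<le> f i x"
    and add: "\<And>i j x y. i \<in> I \<Longrightarrow> j \<in> I \<Longrightarrow> \<exists>k\<in>I. f k (x + y) \<le> f i x + f j y"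
    and scale: "\<And>i c x. i \<in> I \<Longrightarrow> 0 < c \<Longrightarrow> \<exists>k\<in>I. f k (c *\<^sub>R x) \<le> c * f i x"
    and zero: "\<And>i. i \<in> I \<Longrightarrow> f i 0 = 0"
  shows "sublinear (\<lambda>x. INF i\<in>I. f i x)"
proof (rule sublinearI)
  have bdd: "bdd_below ((\<lambda>i. f i x) ` I)" for x
    using lower by (intro bdd_belowI2[where m = "b x"]) auto
  have INF_le: "(INF i\<in>I. f i x) \<le> f k x" if "k \<in> I" for k x
    using that bdd by (rule cINF_lower[rotated])
  fix x y :: 'b and c :: real
  show "(INF i\<in>I. f i (x + y)) \<le> (INF i\<in>I. f i x) + (INF i\<in>I. f i y)"
  proof -
    have "(INF i\<in>I. f i (x + y)) \<le> f i x + f j y" if "i \<in> I" "j \<in> I" for i j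
      using add[OF that, of x y] INF_le order_trans by blast
    then have "(INF i\<in>I. f i (x + y)) - f i x \<le> (INF j\<in>I. f j y)" if "i \<in> I" for i
      using that by (intro cINF_greatest[OF I]) (simp add: diff_le_eq add.commute[of _ "f i x"])
    then have "(INF i\<in>I. f i (x + y)) - (INF j\<in>I. f j y) \<le> (INF i\<in>I. f i x)"
      by (intro cINF_greatest[OF I]) (simp add: algebra_simps)
    then show ?thesis by simp
  qed
  show "(INF i\<in>I. f i (c *\<^sub>R x)) \<le> c * (INF i\<in>I. f i x)" if "0 < c"
  proof -
    have "(INF i\<in>I. f i (c *\<^sub>R x)) / c \<le> f i x" if "i \<in> I" for i
      using scale[OF that \<open>0 < c\<close>, of x] INF_le[of _ "c *\<^sub>R x"] \<open>0 < c\<close>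
      by (fastforce simp: field_simps)
    then have "(INF i\<in>I. f i (c *\<^sub>R x)) / c \<le> (INF i\<in>I. f i x)"
      by (rule cINF_greatest[OF I])
    with that show ?thesis by (simp add: field_simps)
  qed
  show "(INF i\<in>I. f i 0) = 0"
    using I by (simp add: zero cong: INF_cong)
qed

text \<open>The witness is the infimum over \<open>t \<ge> 0\<close> of
  \<open>q (x + t *\<^sub>R y) - t * q y\<close>. The term for \<open>t = 0\<close> gives
  \<open>r \<le> q\<close> and the term for \<open>t = 1\<close> gives the last inequality.\<close>

lemma sublinear_shift:
  assumes q: "sublinear q"
  obtains r where "sublinear r" "r \<le> q" "\<And>x. r x \<le> q (x + y) - q y"
proof
  define f where "f t x = q (x + t *\<^sub>R y) - t * q y" for t x
  let ?r = "\<lambda>x. INF t\<in>{0..}. f t x"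
  \<comment> \<open>Subadditivity for the sum of \<open>x + t *\<^sub>R y\<close> and
    \<open>- x\<close>, which is \<open>t *\<^sub>R y\<close>, bounds all terms from below
    independently of \<open>t\<close>.\<close>
  have lower: "- q (- x) \<le> f t x" if "t \<in> {0..}" for t x
    using sublinear_add[OF q, of "x + t *\<^sub>R y" "- x"] sublinear_scaleR[OF q, of t y] that
    by (simp add: f_def)
  have le: "?r x \<le> f t x" if "0 \<le> t" for t x
    using that lower by (intro cINF_lower bdd_belowI2[where m = "- q (- x)"]) auto
  show "sublinear ?r"
  proof (rule sublinear_INF[OF _ lower])
    fix s t c :: real and x z :: 'a
    assume s: "s \<in> {0..}"
    show "\<exists>k\<in>{0..}. f k (x + z) \<le> f s x + f t z" if "t \<in> {0..}"
    proof
      show "f (s + t) (x + z) \<le> f s x + f t z"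
        using sublinear_add[OF q, of "x + s *\<^sub>R y" "z + t *\<^sub>R y"]
        by (simp add: f_def algebra_simps)
    qed (use s that in simp)
    show "\<exists>k\<in>{0..}. f k (c *\<^sub>R x) \<le> c * f s x" if "0 < c"
    proof
      show "f (c * s) (c *\<^sub>R x) \<le> c * f s x"
        using sublinear_scaleR[OF q, of c "x + s *\<^sub>R y"] that
        by (simp add: f_def algebra_simps)
    qed (use s that in simp)
    show "f s 0 = 0"
      using sublinear_scaleR[OF q, of s y] s by (simp add: f_def)
  qed auto
  show "?r \<le> q" using le[of 0] by (auto simp: le_fun_def f_def)
  show "?r x \<le> q (x + y) - q y" for x using le[of 1 x] by (simp add: f_def)
qed

text \<open>A minimal sublinear functional is linear, because shifting it along \<open>y\<close> cannot decrease it.\<close>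

lemma sublinear_dominates_linear:
  assumes q: "sublinear q"
  obtains h where "linear h" "\<And>x. h x \<le> q x"
proof -
  let ?A = "{r. sublinear r \<and> r \<le> q}"
  \<comment> \<open>The order is reversed, so that the maximal element from Zorn's lemma is a
    minimal sublinear functional below \<open>q\<close>.\<close>
  let ?P = "\<lambda>r s. s \<le> (r :: 'a \<Rightarrow> real)"
  have "\<exists>m\<in>?A. \<forall>r\<in>?A. ?P m r \<longrightarrow> r = m"
  proof (rule predicate_Zorn)
    show "partial_order_on ?A (relation_of ?P ?A)"
      by (rule partial_order_on_relation_ofI) auto
    fix C assume C: "C \<in> Chains (relation_of ?P ?A)"
    show "\<exists>u\<in>?A. \<forall>a\<in>C. ?P a u"
    proof (cases "C = {}")
      case True
      with q show ?thesis by auto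
    next
      case False
      have C_A: "sublinear r" "r \<le> q" if "r \<in> C" for r
        using C that by (auto simp: Chains_def relation_of_def)
      have C_chain: "r \<le> s \<or> s \<le> r" if "r \<in> C" "s \<in> C" for r s
        using C that by (auto simp: Chains_def relation_of_def)
      let ?u = "\<lambda>x. INF r\<in>C. r x"
      \<comment> \<open>Since \<open>- r (- x) \<le> r x\<close> and \<open>r \<le> q\<close>, this
        bound is common to the whole chain and its pointwise infimum is finite.\<close>
      have lower: "- q (- x) \<le> r x" if "r \<in> C" for r x
        using C_A[OF that] sublinear_minus[of r x] by (force simp: le_fun_def intro: order_trans[rotated])
      have u: "?u \<le> r" if "r \<in> C" for r
        using that lower
        by (auto simp: le_fun_def intro!: cINF_lower bdd_belowI2[where m = "- q (- _)"])
      have "sublinear ?u"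
      proof (rule sublinear_INF[OF False lower])
        fix r s x y assume rs: "r \<in> C" "s \<in> C"
        have "r (x + y) \<le> r x + r y" "s (x + y) \<le> s x + s y"
          using C_A rs by (auto intro: sublinear_add)
        \<comment> \<open>The smaller of the two comparable functionals serves as the index required
          by \<open>sublinear_INF\<close>.\<close>
        with C_chain[OF rs] have "r (x + y) \<le> r x + s y \<or> s (x + y) \<le> r x + s y"
          by (auto simp: le_fun_def) (smt (verit))+
        with rs show "\<exists>k\<in>C. k (x + y) \<le> r x + s y" by blast
      qed (auto simp: C_A sublinear_zero sublinear_scaleR intro!: bexI)
      with False u C_A show ?thesis
        by (intro bexI[of _ ?u]) (auto intro: order_trans)
    qed
  qed
  then obtain m where m: "sublinear m" "m \<le> q"
    and minimal: "\<And>r. sublinear r \<Longrightarrow> r \<le> m \<Longrightarrow> r = m"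
    by (auto intro: order_trans)
  have add: "m (x + y) = m x + m y" for x y
  proof -
    obtain r where "sublinear r" "r \<le> m" "r x \<le> m (x + y) - m y"
      using sublinear_shift[OF m(1)] by metis
    with minimal have "m x \<le> m (x + y) - m y" by metis
    with sublinear_add[OF m(1), of x y] show ?thesis by simp
  qed
  have minus: "m (- x) = - m x" for x
    using add[of x "- x"] sublinear_zero[OF m(1)] by simp
  have "linear m"
  proof (rule linearI)
    show "m (c *\<^sub>R x) = c *\<^sub>R m x" for c x
      using sublinear_scaleR[OF m(1), of c x] sublinear_scaleR[OF m(1), of "- c" x] minus[of "c *\<^sub>R x"]
      by (cases "0 \<le> c") auto
  qed (rule add)
  with m(2) show ?thesis by (intro that) (auto simp: le_fun_def)
qed

text \<open>Shifting the norm along \<open>a\<close> yields \<open>r\<close> with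
  \<open>r (- a) \<le> - norm a\<close>. Every linear \<open>h\<close> below \<open>r\<close> then
  satisfies \<open>h a \<ge> norm a\<close>, while \<open>r \<le> norm\<close> gives the opposite
  bound.\<close>

lemma norming_functional:
  fixes a :: "'v::real_normed_vector"
  obtains h :: "'v \<Rightarrow> real" where "bounded_linear h" "\<And>x. \<bar>h x\<bar> \<le> norm x" "h a = norm a"
proof -
  have "sublinear (norm :: 'v \<Rightarrow> real)"
    by (simp add: sublinear_def norm_triangle_ineq)
  then obtain r :: "'v \<Rightarrow> real" where r: "sublinear r" "r \<le> norm"
    "\<And>x. r x \<le> norm (x + a) - norm a"
    using sublinear_shift by metis
  obtain h where h: "linear h" "\<And>x. h x \<le> r x"
    using sublinear_dominates_linear[OF r(1)] by metis
  have le: "h x \<le> norm x" for x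
    using h(2)[of x] r(2) by (auto simp: le_fun_def intro: order_trans)
  have abs: "\<bar>h x\<bar> \<le> norm x" for x
    using le[of x] le[of "- x"] linear_neg[OF h(1), of x] by simp
  have "h a = norm a"
    using h(2)[of "- a"] r(3)[of "- a"] le[of a] linear_neg[OF h(1), of a] by simp
  moreover have "bounded_linear h"
    using h(1) abs by (intro bounded_linear_intro[where K = 1]) (auto simp: linear_add linear_cmul)
  ultimately show ?thesis using abs that by blast
qed


section \<open>Strongly measurable functions\<close>

lemma strongly_measurable_compose2:
  assumes "strongly_measurable N f" "strongly_measurable N g"
    and "continuous_on UNIV (\<lambda>z. h (fst z) (snd z))"
  shows "strongly_measurable N (\<lambda>x. h (f x) (g x))"
proof -
  obtain s t where s: "\<And>i. simple_function N (s i)" "\<And>x. x \<in> space N \<Longrightarrow> (\<lambda>i. s i x) \<longlonglongrightarrow> f x"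
    and t: "\<And>i. simple_function N (t i)" "\<And>x. x \<in> space N \<Longrightarrow> (\<lambda>i. t i x) \<longlonglongrightarrow> g x"
    using assms(1,2) unfolding strongly_measurable_def by blast
  have "(\<lambda>i. h (s i x) (t i x)) \<longlonglongrightarrow> h (f x) (g x)" if "x \<in> space N" for x
    using continuous_on_tendsto_compose[OF assms(3) tendsto_Pair[OF s(2)[OF that] t(2)[OF that]]]
    by simp
  with s(1) t(1) show ?thesis
    unfolding strongly_measurable_def
    by (intro exI[of _ "\<lambda>i x. h (s i x) (t i x)"]) (auto intro: simple_function_compose2)
qed

lemma strongly_measurable_simple: "simple_function N s \<Longrightarrow> strongly_measurable N s"
  unfolding strongly_measurable_def by (intro exI[of _ "\<lambda>_. s"]) auto

lemma strongly_measurable_add: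
  "strongly_measurable N f \<Longrightarrow> strongly_measurable N g \<Longrightarrow> strongly_measurable N (\<lambda>x. f x + g x)"
  by (rule strongly_measurable_compose2[where h = "(+)"]) (auto intro!: continuous_intros)

lemma strongly_measurable_diff:
  "strongly_measurable N f \<Longrightarrow> strongly_measurable N g \<Longrightarrow> strongly_measurable N (\<lambda>x. f x - g x)"
  by (rule strongly_measurable_compose2[where h = "(-)"]) (auto intro!: continuous_intros)

lemma strongly_measurable_scaleR:
  "strongly_measurable N f \<Longrightarrow> strongly_measurable N (\<lambda>x. c *\<^sub>R f x)"
  by (rule strongly_measurable_compose2[where h = "\<lambda>y _. c *\<^sub>R y"])
     (auto intro!: continuous_intros)

lemma borel_measurable_strongly_measurable:
  assumes "strongly_measurable N f"
  shows "f \<in> borel_measurable N"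
proof -
  obtain s where s: "\<And>i. simple_function N (s i)" "\<And>x. x \<in> space N \<Longrightarrow> (\<lambda>i. s i x) \<longlonglongrightarrow> f x"
    using assms unfolding strongly_measurable_def by blast
  show ?thesis
    by (rule borel_measurable_LIMSEQ_metric[of s])
       (auto intro: s borel_measurable_simple_function)
qed

lemma borel_measurable_bounded_linear:
  assumes "strongly_measurable N f" "bounded_linear h"
  shows "(\<lambda>x. h (f x)) \<in> borel_measurable N"
  using measurable_compose[OF borel_measurable_strongly_measurable[OF assms(1)]
      borel_measurable_continuous_onI[OF linear_continuous_on[OF assms(2)]]]
  by simp

text \<open>The range of \<open>f\<close> is separable, so countably many norming functionals detect \<open>f x \<noteq> 0\<close>.\<close>

lemma strongly_measurable_nonzero_functional:
  fixes f :: "'a \<Rightarrow> 'b::real_normed_vector"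
  assumes f: "strongly_measurable M f" and nz: "\<not> (AE x in M. f x = 0)"
  obtains h where "bounded_linear h" "\<And>y. \<bar>h y\<bar> \<le> norm y" "\<not> (AE x in M. h (f x) \<le> 0)"
proof -
  obtain s where s: "\<And>i. simple_function M (s i)" "\<And>x. x \<in> space M \<Longrightarrow> (\<lambda>i. s i x) \<longlonglongrightarrow> f x"
    using f unfolding strongly_measurable_def by blast
  \<comment> \<open>A countable union of finite ranges whose closure contains the range of
    \<open>f\<close>.\<close>
  define C where "C = (\<Union>i. s i ` space M)"
  have C: "countable C"
    unfolding C_def by (simp add: countable_finite simple_functionD(1)[OF s(1)])
  obtain h :: "'b \<Rightarrow> 'b \<Rightarrow> real" where h: "\<And>c. bounded_linear (h c)"
    "\<And>c y. \<bar>h c y\<bar> \<le> norm y" "\<And>c. h c c = norm c"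
    using norming_functional by metis
  have "\<exists>c\<in>C. \<not> (AE x in M. h c (f x) \<le> 0)"
  proof (rule ccontr)
    assume "\<not> ?thesis"
    then have "AE x in M. \<forall>c\<in>C. h c (f x) \<le> 0"
      using C by (simp add: AE_ball_countable)
    then have "AE x in M. f x = 0"
    proof (rule AE_mp, intro AE_I2 impI)
      fix x assume x: "x \<in> space M" and le: "\<forall>c\<in>C. h c (f x) \<le> 0"
      \<comment> \<open>With \<open>c = s i x\<close>, the norming property
        \<open>h c c = norm c\<close> and \<open>h c (f x) \<le> 0\<close> give
        \<open>norm c \<le> h c (c - f x)\<close>. In the limit this forces
        \<open>f x = 0\<close>.\<close>
      have "norm (s i x) \<le> norm (s i x - f x)" for i
      proof -
        have "s i x \<in> C" using x by (auto simp: C_def)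
        with le have "norm (s i x) \<le> h (s i x) (s i x) - h (s i x) (f x)"
          by (simp add: h(3))
        also have "\<dots> \<le> norm (s i x - f x)"
          using h(2)[of "s i x" "s i x - f x"] bounded_linear.linear[OF h(1)]
          by (simp add: linear_diff)
        finally show ?thesis .
      qed
      moreover have "(\<lambda>i. norm (s i x - f x)) \<longlonglongrightarrow> 0"
        using s(2)[OF x] by (simp add: LIM_zero tendsto_norm_zero)
      moreover have "(\<lambda>i. norm (s i x)) \<longlonglongrightarrow> norm (f x)"
        using s(2)[OF x] by (rule tendsto_norm)
      ultimately have "norm (f x) \<le> 0"
        by (intro LIMSEQ_le) auto
      then show "f x = 0" by simp
    qed
    with nz show False ..
  qed
  with h that show ?thesis by blast
qed


section \<open>The dual of the Bochner space separates points\<close>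

lemma bochner_integrable_add:
  assumes "bochner_integrable M f" "bochner_integrable M g"
  shows "bochner_integrable M (\<lambda>x. f x + g x)"
proof -
  obtain s t where s: "\<And>i. Bochner_Integration.simple_bochner_integrable M (s i)"
      "(\<lambda>i. \<integral>\<^sup>+x. ennreal (norm (f x - s i x)) \<partial>M) \<longlonglongrightarrow> 0"
    and t: "\<And>i. Bochner_Integration.simple_bochner_integrable M (t i)"
      "(\<lambda>i. \<integral>\<^sup>+x. ennreal (norm (g x - t i x)) \<partial>M) \<longlonglongrightarrow> 0"
    and fg: "strongly_measurable M f" "strongly_measurable M g"
    using assms unfolding bochner_integrable_def by blast
  have [measurable]: "(\<lambda>x. f x - s i x) \<in> borel_measurable M"
    "(\<lambda>x. g x - t i x) \<in> borel_measurable M" for i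
    using s(1)[of i] t(1)[of i] fg
    by (simp_all add: simple_bochner_integrable.simps borel_measurable_strongly_measurable
        strongly_measurable_diff strongly_measurable_simple)
  have le: "(\<integral>\<^sup>+x. ennreal (norm (f x + g x - (s i x + t i x))) \<partial>M)
      \<le> (\<integral>\<^sup>+x. ennreal (norm (f x - s i x)) \<partial>M) + (\<integral>\<^sup>+x. ennreal (norm (g x - t i x)) \<partial>M)" for i
  proof -
    have "(\<integral>\<^sup>+x. ennreal (norm (f x + g x - (s i x + t i x))) \<partial>M)
        \<le> (\<integral>\<^sup>+x. ennreal (norm (f x - s i x)) + ennreal (norm (g x - t i x)) \<partial>M)"
      by (intro nn_integral_mono)
         (auto simp: ennreal_plus[symmetric] norm_diff_triangle_ineq simp del: ennreal_plus)
    also have "\<dots> = (\<integral>\<^sup>+x. ennreal (norm (f x - s i x)) \<partial>M) + (\<integral>\<^sup>+x. ennreal (norm (g x - t i x)) \<partial>M)"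
      by (rule nn_integral_add) measurable
    finally show ?thesis .
  qed
  have "(\<lambda>i. \<integral>\<^sup>+x. ennreal (norm (f x + g x - (s i x + t i x))) \<partial>M) \<longlonglongrightarrow> 0"
    by (rule tendsto_sandwich[OF _ _ tendsto_const])
       (use le tendsto_add[OF s(2) t(2)] in auto)
  moreover have "Bochner_Integration.simple_bochner_integrable M (\<lambda>x. s i x + t i x)" for i
    using simple_bochner_integrable_compose2[OF _ s(1) t(1), of "(+)" i i] by simp
  ultimately show ?thesis
    unfolding bochner_integrable_def using strongly_measurable_add[OF fg]
    by (intro conjI exI[of _ "\<lambda>i x. s i x + t i x"]) auto
qed

lemma bochner_integrable_scaleR:
  assumes "bochner_integrable M f"
  shows "bochner_integrable M (\<lambda>x. c *\<^sub>R f x)"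
proof -
  obtain s where s: "\<And>i. Bochner_Integration.simple_bochner_integrable M (s i)"
      "(\<lambda>i. \<integral>\<^sup>+x. ennreal (norm (f x - s i x)) \<partial>M) \<longlonglongrightarrow> 0"
    and f: "strongly_measurable M f"
    using assms unfolding bochner_integrable_def by blast
  have [measurable]: "(\<lambda>x. f x - s i x) \<in> borel_measurable M" for i
    using s(1)[of i] f
    by (simp add: simple_bochner_integrable.simps borel_measurable_strongly_measurable
        strongly_measurable_diff strongly_measurable_simple)
  have "(\<integral>\<^sup>+x. ennreal (norm (c *\<^sub>R f x - c *\<^sub>R s i x)) \<partial>M)
      = ennreal \<bar>c\<bar> * (\<integral>\<^sup>+x. ennreal (norm (f x - s i x)) \<partial>M)" for i
  proof -
    have "(\<integral>\<^sup>+x. ennreal (norm (c *\<^sub>R f x - c *\<^sub>R s i x)) \<partial>M)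
        = (\<integral>\<^sup>+x. ennreal \<bar>c\<bar> * ennreal (norm (f x - s i x)) \<partial>M)"
      by (simp add: scaleR_diff_right[symmetric] ennreal_mult)
    also have "\<dots> = ennreal \<bar>c\<bar> * (\<integral>\<^sup>+x. ennreal (norm (f x - s i x)) \<partial>M)"
      by (rule nn_integral_cmult) measurable
    finally show ?thesis .
  qed
  moreover have "(\<lambda>i. ennreal \<bar>c\<bar> * (\<integral>\<^sup>+x. ennreal (norm (f x - s i x)) \<partial>M)) \<longlonglongrightarrow> ennreal \<bar>c\<bar> * 0"
    by (intro ennreal_tendsto_cmult s(2)) simp
  moreover have "Bochner_Integration.simple_bochner_integrable M (\<lambda>x. c *\<^sub>R s i x)" for i
    using simple_bochner_integrable_compose2[OF _ s(1) s(1), of "\<lambda>y _. c *\<^sub>R y" i i] by simp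
  ultimately show ?thesis
    unfolding bochner_integrable_def using strongly_measurable_scaleR[OF f]
    by (intro conjI exI[of _ "\<lambda>i x. c *\<^sub>R s i x"]) auto
qed

section \<open>The vector space of p-integrable functions\<close>

lemma Lp_fun_strongly_measurable: "f \<in> Lp_fun M p \<Longrightarrow> strongly_measurable M f"
  by (simp add: Lp_fun_def bochner_integrable_def)

lemma Lp_fun_integrable_powr: "f \<in> Lp_fun M p \<Longrightarrow> integrable M (\<lambda>x. norm (f x) powr p)"
  by (simp add: Lp_fun_def)

text \<open>This elementary bound yields integrability of the norm from integrability of its p-th
  power on a probability space.\<close>

lemma le_one_plus_powr:
  fixes a p :: real
  assumes "0 \<le> a" "1 \<le> p"
  shows "a \<le> 1 + a powr p"
proof (cases "a \<le> 1")
  case True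
  then show ?thesis by (rule order_trans) simp
next
  case False
  with assms have "a powr 1 \<le> a powr p" by (intro powr_mono) auto
  with False show ?thesis by simp
qed

text \<open>Bounding the sum by twice the maximum gives a crude constant, which suffices for closure
  under addition.\<close>

lemma powr_add_le:
  fixes a b p :: real
  assumes "0 \<le> a" "0 \<le> b" "0 \<le> p"
  shows "(a + b) powr p \<le> 2 powr p * (a powr p + b powr p)"
proof -
  have "(a + b) powr p \<le> (2 * max a b) powr p"
    using assms by (intro powr_mono2) auto
  also have "\<dots> = 2 powr p * (max a b powr p)"
    using assms by (simp add: powr_mult)
  also have "\<dots> \<le> 2 powr p * (a powr p + b powr p)"
    by (auto simp: max_def)
  finally show ?thesis .
qed

lemma Lp_fun_add:
  assumes "0 \<le> p" and f: "f \<in> Lp_fun M p" and g: "g \<in> Lp_fun M p"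
  shows "(\<lambda>x. f x + g x) \<in> Lp_fun M p"
proof -
  have bi: "bochner_integrable M (\<lambda>x. f x + g x)"
    using f g by (simp add: Lp_fun_def bochner_integrable_add)
  then have [measurable]: "(\<lambda>x. f x + g x) \<in> borel_measurable M"
    by (simp add: bochner_integrable_def borel_measurable_strongly_measurable)
  have "integrable M (\<lambda>x. norm (f x + g x) powr p)"
  proof (rule Bochner_Integration.integrable_bound)
    show "integrable M (\<lambda>x. 2 powr p * (norm (f x) powr p + norm (g x) powr p))"
      using f g by (auto simp: Lp_fun_def)
    have "norm (f x + g x) powr p \<le> 2 powr p * (norm (f x) powr p + norm (g x) powr p)" for x
      using powr_mono2[OF assms(1) norm_ge_zero norm_triangle_ineq]
        powr_add_le[of "norm (f x)" "norm (g x)" p] assms(1)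
      by (meson norm_ge_zero order_trans)
    then show "AE x in M. norm (norm (f x + g x) powr p)
        \<le> norm (2 powr p * (norm (f x) powr p + norm (g x) powr p))"
      by (auto intro: order_trans)
  qed measurable
  with bi show ?thesis by (simp add: Lp_fun_def)
qed

lemma Lp_fun_scaleR: "f \<in> Lp_fun M p \<Longrightarrow> (\<lambda>x. c *\<^sub>R f x) \<in> Lp_fun M p"
  by (simp add: Lp_fun_def bochner_integrable_scaleR powr_mult)

section \<open>Equivalence classes and their representatives\<close>

lemma equiv_AE_eq_rel: "equiv (Lp_fun M p) (AE_eq_rel M p)"
proof (rule equivI)
  show "sym (AE_eq_rel M p)"
    by (auto simp: sym_def AE_eq_rel_def)
  show "trans (AE_eq_rel M p)"
    unfolding trans_def AE_eq_rel_def by (auto)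
qed (auto simp: AE_eq_rel_def refl_on_def)

text \<open>Members of one quotient class are related by \<open>AE_eq_rel\<close>, so each of them
  may serve as its representative.\<close>

lemma Lp_class_eq:
  assumes "u \<in> Lp M p N" "f \<in> u"
  shows "u = Lp_class M p f" "f \<in> Lp_fun M p"
proof -
  obtain g where g: "g \<in> Lp_fun M p" "u = AE_eq_rel M p `` {g}"
    using assms(1) by (auto simp: Lp_def elim: quotientE)
  with assms(2) have gf: "(g, f) \<in> AE_eq_rel M p" by simp
  then show "f \<in> Lp_fun M p" by (simp add: AE_eq_rel_def)
  show "u = Lp_class M p f"
    unfolding Lp_class_def g(2) by (rule equiv_class_eq[OF equiv_AE_eq_rel gf])
qed

lemma mem_Lp_class: "f \<in> Lp_fun M p \<Longrightarrow> f \<in> Lp_class M p f"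
  by (simp add: Lp_class_def AE_eq_rel_def)

lemma mem_Lp_class_iff:
  "f \<in> Lp_fun M p \<Longrightarrow> g \<in> Lp_class M p f \<longleftrightarrow> g \<in> Lp_fun M p \<and> (AE x in M. f x = g x)"
  by (simp add: Lp_class_def AE_eq_rel_def)

context prob_space
begin

section \<open>Functionals given by integrals over measurable sets\<close>

lemma Lp_fun_integrable_norm:
  assumes "1 \<le> p" and f: "f \<in> Lp_fun M p"
  shows "integrable M (\<lambda>x. norm (f x))"
proof (rule Bochner_Integration.integrable_bound)
  show "integrable M (\<lambda>x. 1 + norm (f x) powr p)"
    using Lp_fun_integrable_powr[OF f] by simp
  show "(\<lambda>x. norm (f x)) \<in> borel_measurable M"
    using borel_measurable_strongly_measurable[OF Lp_fun_strongly_measurable[OF f]] by measurable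
  show "AE x in M. norm (norm (f x)) \<le> norm (1 + norm (f x) powr p)"
    using le_one_plus_powr[OF norm_ge_zero assms(1)] by auto
qed

text \<open>
  The constant 2 stands in for the optimal 1 of Jensen's inequality: with \<open>r\<close> the norm of \<open>f\<close> one
  integrates \<open>\<bar>f\<bar> / r \<le> 1 + (\<bar>f\<bar> / r) powr p\<close>.
\<close>

lemma integral_norm_le_Lp_fun_norm:
  assumes p: "1 \<le> p" and f: "f \<in> Lp_fun M p"
  shows "(\<integral>x. norm (f x) \<partial>M) \<le> 2 * Lp_fun_norm M p f"
proof -
  let ?I = "\<integral>x. norm (f x) powr p \<partial>M"
  define r where "r = Lp_fun_norm M p f"
  have I: "0 \<le> ?I" by simp
  have r_powr: "r powr p = ?I"
    using p I by (simp add: r_def Lp_fun_norm_def powr_powr)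
  show ?thesis
  \<comment> \<open>If the integral vanishes then \<open>r = 0\<close> and division by
    \<open>r\<close> is impossible; in that case \<open>f\<close> is zero almost everywhere.\<close>
  proof (cases "?I = 0")
    case True
    then have "AE x in M. norm (f x) powr p = 0"
      using integral_nonneg_eq_0_iff_AE[OF Lp_fun_integrable_powr[OF f]] by simp
    then have "AE x in M. norm (f x) = 0" by simp
    then have "(\<integral>x. norm (f x) \<partial>M) = 0" by (rule integral_eq_zero_AE)
    then show ?thesis by (simp add: Lp_fun_norm_def)
  next
    case False
    with I have r: "0 < r" by (simp add: r_def Lp_fun_norm_def)
    have "(\<integral>x. norm (f x) \<partial>M) \<le> (\<integral>x. r + r * (norm (f x) powr p / ?I) \<partial>M)"
    proof (rule integral_mono)
      show "integrable M (\<lambda>x. norm (f x))" using p f by (rule Lp_fun_integrable_norm)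
      show "integrable M (\<lambda>x. r + r * (norm (f x) powr p / ?I))"
        using Lp_fun_integrable_powr[OF f] by simp
      fix x
      have "norm (f x) / r \<le> 1 + (norm (f x) / r) powr p"
        using p r by (intro le_one_plus_powr) auto
      also have "(norm (f x) / r) powr p = norm (f x) powr p / ?I"
        using r by (simp add: powr_divide r_powr)
      finally show "norm (f x) \<le> r + r * (norm (f x) powr p / ?I)"
        using r by (simp add: field_simps)
    qed
    also have "\<dots> = 2 * r"
      using Lp_fun_integrable_powr[OF f] False by (simp add: prob_space)
    finally show ?thesis by (simp add: r_def)
  qed
qed

lemma integrable_indicator_functional:
  fixes h :: "'b::real_normed_vector \<Rightarrow> real"
  assumes p: "1 \<le> p" and h: "bounded_linear h" "\<And>y. \<bar>h y\<bar> \<le> norm y" and E: "E \<in> sets M"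
    and f: "f \<in> Lp_fun M p"
  shows "integrable M (\<lambda>x. indicator E x * h (f x))"
  using Lp_fun_integrable_norm[OF p f]
proof (rule Bochner_Integration.integrable_bound)
  show "(\<lambda>x. indicator E x * h (f x)) \<in> borel_measurable M"
    using borel_measurable_bounded_linear[OF Lp_fun_strongly_measurable[OF f] h(1)] E
    by measurable
qed (use h(2) in \<open>auto simp: indicator_def\<close>)

text \<open>The integral depends only on the class of \<open>f\<close>, and it is bounded by the
  integral of \<open>norm (f x)\<close>, hence by twice the norm in \<open>Lp_fun_norm\<close>. The
  set \<open>E\<close> is taken from \<open>M\<close>, and the functional on the full space is
  restricted to the subspace for \<open>N\<close>.\<close>

lemma Lp_dual_set_integral:
  fixes h :: "'b::real_normed_vector \<Rightarrow> real"
  assumes p: "1 \<le> p" and h: "bounded_linear h" "\<And>y. \<bar>h y\<bar> \<le> norm y" and E: "E \<in> sets M"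
  obtains l where "l \<in> Lp_dual M p N"
    "\<And>f. f \<in> Lp_fun M p \<Longrightarrow> l (Lp_class M p f) = (\<integral>x. indicator E x * h (f x) \<partial>M)"
proof
  define J where "J f = (\<integral>x. indicator E x * h (f x) \<partial>M)" for f
  \<comment> \<open>The choice of representative is harmless: almost everywhere equal functions have
    the same \<open>J\<close>, which is what the next claim on \<open>l\<close> records.\<close>
  define l where "l u = J (SOME f. f \<in> u)" for u
  note int = integrable_indicator_functional[OF p h E]
  show l: "l (Lp_class M p f) = J f" if f: "f \<in> Lp_fun M p" for f
  proof -
    have "(SOME g. g \<in> Lp_class M p f) \<in> Lp_class M p f"
      by (rule someI[where P = "\<lambda>g. g \<in> Lp_class M p f", OF mem_Lp_class[OF f]])
    then show ?thesis
      unfolding l_def J_def using f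
      by (intro integral_cong_AE borel_measurable_integrable int) (auto simp: mem_Lp_class_iff)
  qed
  have "\<bar>J f\<bar> \<le> 2 * Lp_fun_norm M p f" if f: "f \<in> Lp_fun M p" for f
  proof -
    have "\<bar>J f\<bar> \<le> (\<integral>x. \<bar>indicator E x * h (f x)\<bar> \<partial>M)"
      unfolding J_def by (rule integral_abs_bound)
    also have "\<dots> \<le> (\<integral>x. norm (f x) \<partial>M)"
      using int[OF f] Lp_fun_integrable_norm[OF p f] h(2)
      by (intro integral_mono) (auto simp: indicator_def)
    also have "\<dots> \<le> 2 * Lp_fun_norm M p f"
      using p f by (rule integral_norm_le_Lp_fun_norm)
    finally show ?thesis .
  qed
  moreover have "J (\<lambda>x. f x + g x) = J f + J g" if "f \<in> Lp_fun M p" "g \<in> Lp_fun M p" for f g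
    unfolding J_def using int[OF that(1)] int[OF that(2)] bounded_linear.linear[OF h(1)]
    by (simp add: linear_add distrib_left)
  moreover have "J (\<lambda>x. c *\<^sub>R f x) = c * J f" for c f
    unfolding J_def using bounded_linear.linear[OF h(1)]
    by (simp add: linear_cmul mult.left_commute)
  ultimately have J:
    "\<And>f. f \<in> Lp_fun M p \<Longrightarrow> \<bar>J f\<bar> \<le> 2 * Lp_fun_norm M p f"
    "\<And>f g. f \<in> Lp_fun M p \<Longrightarrow> g \<in> Lp_fun M p \<Longrightarrow> J (\<lambda>x. f x + g x) = J f + J g"
    "\<And>c f. J (\<lambda>x. c *\<^sub>R f x) = c * J f"
    by auto
  have l_J: "l u = J f" "f \<in> Lp_fun M p" if "u \<in> Lp M p N" "f \<in> u"
    for u :: "('a, 'b) Lp_class" and f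
    using Lp_class_eq[OF that] l by auto
  have p0: "0 \<le> p" using p by simp
  show "l \<in> Lp_dual M p N"
    unfolding Lp_dual_def
  \<comment> \<open>The bound \<open>2\<close> is the constant from
    \<open>integral_norm_le_Lp_fun_norm\<close>.\<close>
  proof (intro CollectI conjI ballI allI exI[of _ 2])
    fix u v :: "('a, 'b) Lp_class" and f g c
    assume u: "u \<in> Lp M p N" "f \<in> u"
    show "\<bar>l u\<bar> \<le> 2 * Lp_fun_norm M p f"
      using l_J[OF u] J(1) by simp
    show "l (Lp_class M p (\<lambda>x. c *\<^sub>R f x)) = c * l u"
      using l_J[OF u] J(3) by (simp add: l Lp_fun_scaleR)
    assume v: "v \<in> Lp M p N" "g \<in> v"
    show "l (Lp_class M p (\<lambda>x. f x + g x)) = l u + l v"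
      using l_J[OF u] l_J[OF v] J(2) by (simp add: l Lp_fun_add[OF p0])
  qed
qed

text \<open>Representatives of distinct classes differ on a non-null set, so some norming functional
  \<open>h\<close> is positive on their difference with positive probability. Integrating
  \<open>h\<close> over that event tells the classes apart.\<close>

lemma Lp_dual_separates:
  fixes u v :: "('a, 'b::real_normed_vector) Lp_class"
  assumes p: "1 \<le> p" and u: "u \<in> Lp M p N" and v: "v \<in> Lp M p N" and "u \<noteq> v"
  obtains l where "l \<in> Lp_dual M p N" "l u \<noteq> l v"
proof -
  obtain f g where fg: "f \<in> u" "g \<in> v"
    using u v by (auto simp: Lp_def)
  note f = Lp_class_eq[OF u fg(1)] and g = Lp_class_eq[OF v fg(2)]
  let ?d = "\<lambda>x. f x - g x"
  have d: "?d \<in> Lp_fun M p"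
    using Lp_fun_add[OF _ f(2) Lp_fun_scaleR[OF g(2), of "- 1"]] p by simp
  have "\<not> (AE x in M. ?d x = 0)"
  proof
    assume "AE x in M. ?d x = 0"
    then have "(f, g) \<in> AE_eq_rel M p" using f(2) g(2) by (simp add: AE_eq_rel_def)
    then have "u = v"
      unfolding f(1) g(1) Lp_class_def by (rule equiv_class_eq[OF equiv_AE_eq_rel])
    with \<open>u \<noteq> v\<close> show False ..
  qed
  then obtain h :: "'b \<Rightarrow> real" where h: "bounded_linear h" "\<And>y. \<bar>h y\<bar> \<le> norm y"
    "\<not> (AE x in M. h (?d x) \<le> 0)"
    using strongly_measurable_nonzero_functional[OF Lp_fun_strongly_measurable[OF d]] by metis
  have meas[measurable]: "(\<lambda>x. h (?d x)) \<in> borel_measurable M"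
    using borel_measurable_bounded_linear[OF Lp_fun_strongly_measurable[OF d] h(1)] .
  \<comment> \<open>On this set the integrand \<open>h (?d x)\<close> is positive, so a vanishing
    integral would force \<open>h (?d x) \<le> 0\<close> almost everywhere.\<close>
  define E where "E = {x \<in> space M. 0 < h (?d x)}"
  have E: "E \<in> sets M" unfolding E_def by measurable
  obtain l where l: "l \<in> Lp_dual M p N"
    "\<And>f. f \<in> Lp_fun M p \<Longrightarrow> l (Lp_class M p f) = (\<integral>x. indicator E x * h (f x) \<partial>M)"
    using Lp_dual_set_integral[OF p h(1,2) E] by metis
  note int = integrable_indicator_functional[OF p h(1,2) E]
  have "l u - l v = (\<integral>x. indicator E x * h (?d x) \<partial>M)"
    using int[OF f(2)] int[OF g(2)] bounded_linear.linear[OF h(1)]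
    by (simp add: f(1) g(1) l(2) f(2) g(2) linear_diff right_diff_distrib)
  also have "\<dots> \<noteq> 0"
  proof
    assume "(\<integral>x. indicator E x * h (?d x) \<partial>M) = 0"
    then have "AE x in M. indicator E x * h (?d x) = 0"
      using integral_nonneg_eq_0_iff_AE[OF int[OF d]] by (auto simp: E_def indicator_def)
    then have "AE x in M. h (?d x) \<le> 0"
      by (rule AE_mp) (auto simp: E_def indicator_def)
    with h(3) show False ..
  qed
  finally show ?thesis using l(1) that by auto
qed

text \<open>The union of all subbasic weakly open sets that miss \<open>u\<close> is itself such a
  neighbourhood. It covers \<open>S\<close> because the dual separates each point of
  \<open>S\<close> from \<open>u\<close>.\<close>

lemma weak_nbhd_avoiding_point:
  assumes p: "1 \<le> p" and S: "S \<subseteq> Lp M p N" and u: "u \<in> Lp M p N" "u \<notin> S"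
  obtains V where "nbhd_of (weak_Lp M p N) S V" "u \<notin> V"
proof
  define G where "G = {W. \<exists>l U. W = {v \<in> Lp M p N. l v \<in> U} \<and> l \<in> Lp_dual M p N \<and> open U \<and> l u \<notin> U}"
  have "openin (weak_Lp M p N) (\<Union>G)"
    unfolding weak_Lp_def G_def by (intro openin_Union topology_generated_by_Basis) blast
  moreover have "S \<subseteq> \<Union>G"
  proof
    fix a assume a: "a \<in> S"
    with S u have "a \<in> Lp M p N" "a \<noteq> u" by auto
    then obtain l where "l \<in> Lp_dual M p N" "l a \<noteq> l u"
      using Lp_dual_separates[OF p _ u(1)] by metis
    \<comment> \<open>The complement of the single value \<open>l u\<close> is an open set of reals
      containing \<open>l a\<close>.\<close>
    with \<open>a \<in> Lp M p N\<close> have "{v \<in> Lp M p N. l v \<in> - {l u}} \<in> G" "a \<in> {v \<in> Lp M p N. l v \<in> - {l u}}"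
      by (auto simp: G_def intro!: exI[of _ l] exI[of _ "- {l u}"])
    then show "a \<in> \<Union>G" by blast
  qed
  ultimately show "nbhd_of (weak_Lp M p N) S (\<Union>G)"
    unfolding nbhd_of_def by (auto dest: openin_subset)
  show "u \<notin> \<Union>G" by (auto simp: G_def)
qed

end


section \<open>Complete trajectories\<close>

text \<open>The cocycle law rewritten for instants \<open>r \<le> s \<le> t\<close>, with durations
  as differences.\<close>

lemma mean_RDS_compose:
  assumes "mean_RDS M p F \<Phi>" "u \<in> Lp M p (F r)" "r \<le> s" "s \<le> t"
  shows "\<Phi> (t - r) r u = \<Phi> (t - s) s (\<Phi> (s - r) r u)"
proof -
  have "\<Phi> ((t - s) + (s - r)) r u = \<Phi> (t - s) ((s - r) + r) (\<Phi> (s - r) r u)"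
    using assms unfolding mean_RDS_def by (metis diff_ge_0_iff_ge)
  then show ?thesis by simp
qed

lemma invariant_family_mem:
  assumes "invariant_family \<Phi> A" "u \<in> A s" "s \<le> t"
  shows "\<Phi> (t - s) s u \<in> A t"
proof -
  have "A t = \<Phi> (t - s) (t - (t - s)) ` A (t - (t - s))"
    using assms(1,3) unfolding invariant_family_def by (meson diff_ge_0_iff_ge)
  with assms(2) show ?thesis by simp
qed

text \<open>Invariance makes each unit step onto, so dependent choice gives a backward orbit at the
  times \<open>t - n\<close>. Flowing forward from these nodes fills in all real times.\<close>

lemma complete_trajectory_through:
  assumes \<Phi>: "mean_RDS M p F \<Phi>" and A: "invariant_family \<Phi> A" and Lp: "\<And>t. A t \<subseteq> Lp M p (F t)"
    and u: "u \<in> A t"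
  obtains \<phi> where "complete_trajectory M p F \<Phi> \<phi>" "\<And>s. \<phi> s \<in> A s" "\<phi> t = u"
proof -
  \<comment> \<open>The clause for \<open>n = 0\<close> fixes the start of the chosen sequence at
    \<open>u\<close>.\<close>
  have "\<exists>x. \<forall>n. (x n \<in> A (t - real n) \<and> (n = 0 \<longrightarrow> x n = u))
      \<and> \<Phi> 1 (t - real (Suc n)) (x (Suc n)) = x n"
  proof (rule dependent_nat_choice)
    show "\<exists>x. x \<in> A (t - real 0) \<and> (0 = (0::nat) \<longrightarrow> x = u)" using u by auto
    fix y n assume "y \<in> A (t - real n) \<and> (n = 0 \<longrightarrow> y = u)"
    moreover have "A (t - real n) = \<Phi> 1 (t - real n - 1) ` A (t - real n - 1)"
      using A unfolding invariant_family_def by (metis zero_le_one)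
    ultimately show "\<exists>z. (z \<in> A (t - real (Suc n)) \<and> (Suc n = 0 \<longrightarrow> z = u)) \<and>
        \<Phi> 1 (t - real (Suc n)) z = y"
      by (auto simp: algebra_simps)
  qed
  then obtain x where x: "\<And>n. x n \<in> A (t - real n)" "x 0 = u"
    "\<And>n. \<Phi> 1 (t - real (Suc n)) (x (Suc n)) = x n"
    by blast
  have x_Lp: "x n \<in> Lp M p (F (t - real n))" for n
    using x(1) Lp by blast
  \<comment> \<open>The value at time \<open>s\<close> does not depend on the node from which the
    flow starts, provided the node is not later than \<open>s\<close>.\<close>
  have step_back: "\<Phi> (s - (t - real m)) (t - real m) (x m) = \<Phi> (s - (t - real n)) (t - real n) (x n)"
    if "n \<le> m" "t - real n \<le> s" for m n s
    using that(1)
  proof (induction rule: dec_induct)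
    case (step k)
    have "\<Phi> (s - (t - real (Suc k))) (t - real (Suc k)) (x (Suc k))
        = \<Phi> (s - (t - real k)) (t - real k)
            (\<Phi> (t - real k - (t - real (Suc k))) (t - real (Suc k)) (x (Suc k)))"
      using step that(2) by (intro mean_RDS_compose[OF \<Phi> x_Lp]) auto
    also have "t - real k - (t - real (Suc k)) = 1" by simp
    finally show ?case using step x(3) by simp
  qed simp
  \<comment> \<open>The least number of unit steps back from \<open>t\<close> that reaches a time at
    or before \<open>s\<close>; \<open>nat\<close> makes it \<open>0\<close> for all
    \<open>s \<ge> t\<close>.\<close>
  define n where "n s = nat \<lceil>t - s\<rceil>" for s
  define \<phi> where "\<phi> s = \<Phi> (s - (t - real (n s))) (t - real (n s)) (x (n s))" for s
  have n: "t - real (n s) \<le> s" for s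
    unfolding n_def by linarith
  have \<phi>_A: "\<phi> s \<in> A s" for s
    unfolding \<phi>_def by (rule invariant_family_mem[OF A x(1) n])
  have "\<phi> s' = \<Phi> (s' - s) s (\<phi> s)" if "s < s'" for s s'
  proof -
    have "n s' \<le> n s"
      unfolding n_def using that by (intro nat_mono ceiling_mono) simp
    \<comment> \<open>Both values are now computed from the earlier node, that of \<open>s\<close>,
      so the cocycle law can be split at \<open>s\<close>.\<close>
    then have "\<phi> s' = \<Phi> (s' - (t - real (n s))) (t - real (n s)) (x (n s))"
      unfolding \<phi>_def using n by (intro step_back[symmetric])
    also have "\<dots> = \<Phi> (s' - s) s (\<phi> s)"
      unfolding \<phi>_def using that n by (intro mean_RDS_compose[OF \<Phi> x_Lp]) auto
    finally show ?thesis .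
  qed
  then have "complete_trajectory M p F \<Phi> \<phi>"
    using \<phi>_A Lp unfolding complete_trajectory_def by blast
  moreover have "\<phi> t = u"
    using \<Phi> x_Lp[of 0] x(2) unfolding \<phi>_def n_def mean_RDS_def by simp
  ultimately show ?thesis using \<phi>_A that by blast
qed

text \<open>Pulling the trajectory back by any positive time and evolving it forward always returns
  \<open>\<phi> t\<close>, so attraction places this fixed point in every weak neighbourhood of
  \<open>K t\<close>.\<close>

lemma (in prob_space) complete_trajectory_in_attracting:
  assumes p: "1 \<le> p" and K: "pullback_weakly_attracting M p F \<Phi> \<D> K"
    and Lp: "K t \<subseteq> Lp M p (F t)"
    and \<phi>: "complete_trajectory M p F \<Phi> \<phi>" "(\<lambda>s. {\<phi> s}) \<in> \<D>"
  shows "\<phi> t \<in> K t"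
proof (rule ccontr)
  assume "\<phi> t \<notin> K t"
  moreover have "\<phi> t \<in> Lp M p (F t)"
    using \<phi>(1) by (simp add: complete_trajectory_def)
  ultimately obtain V where V: "nbhd_of (weak_Lp M p (F t)) (K t) V" "\<phi> t \<notin> V"
    using weak_nbhd_avoiding_point[OF p Lp] by blast
  have "\<exists>T>0. \<forall>r\<ge>T. \<Phi> r (t - r) ` {\<phi> (t - r)} \<subseteq> V"
    using K[unfolded pullback_weakly_attracting_def, THEN conjunct2, rule_format, OF \<phi>(2) V(1)]
    by simp
  \<comment> \<open>The elapsed time is \<open>T\<close> itself; its positivity matters because the
    trajectory identity is stated for strictly ordered times.\<close>
  then obtain T where T: "0 < T" "\<Phi> T (t - T) (\<phi> (t - T)) \<in> V" by auto
  have "\<phi> t = \<Phi> (t - (t - T)) (t - T) (\<phi> (t - T))"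
    using \<phi>(1)[unfolded complete_trajectory_def, THEN conjunct2, rule_format, of "t - T" t] T(1)
    by simp
  with T V(2) show False by simp
qed

theorem lemma15:
  fixes M :: "'a measure"
    and F :: "real \<Rightarrow> 'a measure"
    and p :: real
    and \<Phi> :: "real \<Rightarrow> real \<Rightarrow> ('a, 'b::banach) Lp_class \<Rightarrow> ('a, 'b) Lp_class"
    and \<D> :: "('a, 'b) Lp_family set"
    and A :: "('a, 'b) Lp_family"
  assumes "complete_filtered_prob_space M F"
    and "1 < p"
    and "Lp_collection M p F \<D>"
    and "inclusion_closed \<D>"
    and "mean_RDS M p F \<Phi>"
    and "weak_mean_random_attractor M p F \<Phi> \<D> A"
    and "invariant_family \<Phi> A"
  shows "\<forall>t. A t = {\<phi> t |\<phi>. complete_trajectory M p F \<Phi> \<phi> \<and> (\<lambda>s. {\<phi> s}) \<in> \<D>}"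
proof (intro allI equalityI subsetI)
  interpret prob_space M
    using assms(1) by (simp add: complete_filtered_prob_space_def)
  have A: "A \<in> \<D>" "pullback_weakly_attracting M p F \<Phi> \<D> A"
    using assms(6) by (simp_all add: weak_mean_random_attractor_def)
  have Lp: "A t \<subseteq> Lp M p (F t)" for t
    using assms(3) A(1) by (simp add: Lp_collection_def)
  fix t u
  show "u \<in> {\<phi> t |\<phi>. complete_trajectory M p F \<Phi> \<phi> \<and> (\<lambda>s. {\<phi> s}) \<in> \<D>}" if u: "u \<in> A t"
  proof -
    obtain \<phi> where \<phi>: "complete_trajectory M p F \<Phi> \<phi>" "\<And>s. \<phi> s \<in> A s" "\<phi> t = u"
      using complete_trajectory_through[OF assms(5,7) Lp u] by blast
    \<comment> \<open>The singletons form a non-empty subfamily of \<open>A\<close>, so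
      inclusion-closedness applies.\<close>
    have "(\<lambda>s. {\<phi> s}) \<in> \<D>"
      by (rule assms(4)[unfolded inclusion_closed_def, rule_format, OF A(1)]) (simp add: \<phi>(2))
    with \<phi> show ?thesis by blast
  qed
  show "u \<in> A t" if u: "u \<in> {\<phi> t |\<phi>. complete_trajectory M p F \<Phi> \<phi> \<and> (\<lambda>s. {\<phi> s}) \<in> \<D>}"
  proof -
    obtain \<phi> where "u = \<phi> t" "complete_trajectory M p F \<Phi> \<phi>" "(\<lambda>s. {\<phi> s}) \<in> \<D>"
      using u by blast
    then show ?thesis
      using complete_trajectory_in_attracting[OF less_imp_le[OF assms(2)] A(2) Lp] by simp
  qed
qed

end
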